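(* Let $X$ be a Banach space and let $I=\Phi+\Psi:X\to(-\infty,\infty]$, with $\Phi:X\to\mathbb{R}$ locally Lipschitz and $\Psi:X\to(-\infty,\infty]$ convex, lower semicontinuous and proper, satisfy the $(\mathrm{PS})$ condition. Let $(c_j)$ be a real sequence such that $c_j\to c\in\mathbb{R}$. Then, given $\delta>0$, there exists $j_0\in\mathbb{N}$ such that $$K_{c_j}\subset N_\delta(K_c),\qquad j\ge j_0 .$$
   Context: $\Phi^\circ(u;v)=\limsup_{w\to u,\,t\to0^+}\frac{\Phi(w+tv)-\Phi(w)}{t}$. A critical point of $I$ is $u$ with $I(u)<\infty$ and $\Phi^\circ(u;v-u)+\Psi(v)-\Psi(u)\ge0$ for all $v\in X$. For $c\in\mathbb{R}$, $K_c$ is the set of critical points $u$ of $I$ with $I(u)=c$. $N_\delta(A)=\{x\in X:d(x,A)\le\delta\}$, with the convention $N_\delta(\emptyset)=\emptyset$. A $(\mathrm{PS})_c$ sequence is $(u_n)$ with $I(u_n)\to c$ and $\Phi^\circ(u_n;v-u_n)+\Psi(v)-\Psi(u_n)\ge-\varepsilon_n\|v-u_n\|$ for all $v\in X$, with $\varepsilon_n\to0^+$. $I$ satisfies $(\mathrm{PS})$ if for every $c\in\mathbb{R}$ every $(\mathrm{PS})_c$ sequence has a convergent subsequence. *)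

theory Defs
  imports "HOL-Analysis.Analysis"
begin

definition locally_lipschitz :: "('a::real_normed_vector \<Rightarrow> real) \<Rightarrow> bool" where
  "locally_lipschitz \<Phi> \<longleftrightarrow> (\<forall>x. \<exists>r>0. \<exists>L. L-lipschitz_on (ball x r) \<Phi>)"

(* The library's convex_on is restricted to real-valued functions.  In type ereal, 0 * \<infinity> = 0,
   so the endpoint cases s = 0 and t = 0 are harmless. *)
definition convex_ereal :: "('a::real_vector \<Rightarrow> ereal) \<Rightarrow> bool" where
  "convex_ereal \<Psi> \<longleftrightarrow>
     (\<forall>x y. \<forall>s\<ge>0. \<forall>t\<ge>0. s + t = 1 \<longrightarrow>
        \<Psi> (s *\<^sub>R x + t *\<^sub>R y) \<le> ereal s * \<Psi> x + ereal t * \<Psi> y)"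

definition lower_semicontinuous :: "('a::topological_space \<Rightarrow> ereal) \<Rightarrow> bool" where
  "lower_semicontinuous \<Psi> \<longleftrightarrow> (\<forall>x. \<Psi> x \<le> Liminf (at x) \<Psi>)"

definition proper :: "('a \<Rightarrow> ereal) \<Rightarrow> bool" where
  "proper \<Psi> \<longleftrightarrow> (\<forall>x. \<Psi> x \<noteq> -\<infinity>) \<and> (\<exists>x. \<Psi> x < \<infinity>)"

(* Clarke's generalized directional derivative of \<Phi> at u in direction v; the base point w may
   equal u.  It is finite whenever \<Phi> is locally Lipschitz. *)
definition clarke_deriv :: "('a::real_normed_vector \<Rightarrow> real) \<Rightarrow> 'a \<Rightarrow> 'a \<Rightarrow> ereal" where
  "clarke_deriv \<Phi> u v =
     Limsup (nhds u \<times>\<^sub>F at_right 0) (\<lambda>(w, t). ereal ((\<Phi> (w + t *\<^sub>R v) - \<Phi> w) / t))"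

definition energy :: "('a \<Rightarrow> real) \<Rightarrow> ('a \<Rightarrow> ereal) \<Rightarrow> 'a \<Rightarrow> ereal" where
  "energy \<Phi> \<Psi> u = ereal (\<Phi> u) + \<Psi> u"

(* Criticality and the (PS) condition below depend on the decomposition I = \<Phi> + \<Psi>, so the pair
   (\<Phi>, \<Psi>), not just the sum, is the parameter. *)
definition critical_point :: "('a::real_normed_vector \<Rightarrow> real) \<Rightarrow> ('a \<Rightarrow> ereal) \<Rightarrow> 'a \<Rightarrow> bool" where
  "critical_point \<Phi> \<Psi> u \<longleftrightarrow>
     energy \<Phi> \<Psi> u < \<infinity> \<and> (\<forall>v. clarke_deriv \<Phi> u (v - u) + \<Psi> v - \<Psi> u \<ge> 0)"

definition critical_set :: "('a::real_normed_vector \<Rightarrow> real) \<Rightarrow> ('a \<Rightarrow> ereal) \<Rightarrow> real \<Rightarrow> 'a set" where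
  "critical_set \<Phi> \<Psi> c = {u. critical_point \<Phi> \<Psi> u \<and> energy \<Phi> \<Psi> u = ereal c}"

(* In type ereal, \<infinity> - \<infinity> = \<infinity>.  For \<Phi> locally Lipschitz and \<Psi> proper this does not matter here:
   if \<Psi> (u n) = \<infinity>, the inequality already fails for any v with \<Psi> v < \<infinity>. *)
definition PS_sequence ::
    "('a::real_normed_vector \<Rightarrow> real) \<Rightarrow> ('a \<Rightarrow> ereal) \<Rightarrow> real \<Rightarrow> (nat \<Rightarrow> 'a) \<Rightarrow> bool" where
  "PS_sequence \<Phi> \<Psi> c u \<longleftrightarrow>
     (\<lambda>n. energy \<Phi> \<Psi> (u n)) \<longlonglongrightarrow> ereal c \<and>
     (\<exists>\<epsilon>::nat \<Rightarrow> real. (\<forall>n. \<epsilon> n > 0) \<and> \<epsilon> \<longlonglongrightarrow> 0 \<and>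
        (\<forall>n v. clarke_deriv \<Phi> (u n) (v - u n) + \<Psi> v - \<Psi> (u n)
                 \<ge> ereal (- \<epsilon> n * norm (v - u n))))"

definition PS_condition :: "('a::real_normed_vector \<Rightarrow> real) \<Rightarrow> ('a \<Rightarrow> ereal) \<Rightarrow> bool" where
  "PS_condition \<Phi> \<Psi> \<longleftrightarrow>
     (\<forall>c u. PS_sequence \<Phi> \<Psi> c u \<longrightarrow> (\<exists>r. strict_mono r \<and> convergent (u \<circ> r)))"

(* The library sets infdist x {} = 0, so the convention that the neighbourhood of the empty set
   is empty has to be stated explicitly. *)
definition closed_nbhd :: "real \<Rightarrow> 'a::metric_space set \<Rightarrow> 'a set" where
  "closed_nbhd \<delta> A = {x. A \<noteq> {} \<and> infdist x A \<le> \<delta>}"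

end

theory Submission
  imports Defs
begin

text \<open>
  Critical points at levels tending to \<open>c\<close> form a \<open>(PS)\<^sub>c\<close> sequence, so it suffices that a limit \<open>u\<close>
  of such points \<open>u\<^sub>n\<close> lies in \<open>K\<^sub>c\<close>. The generalized derivative is jointly upper semicontinuous in
  the base point and the direction, so the inequalities defining criticality pass to the limit once
  \<open>\<Psi>(u\<^sub>n) \<longlonglongrightarrow> \<Psi>(u)\<close>. Lower semicontinuity gives one half of this convergence, and testing the
  criticality of \<open>u\<^sub>n\<close> with \<open>v = u\<close> gives the other.
\<close>

text \<open>The \<open>Liminf\<close> in the definition is over the punctured filter
  \<open>at x\<close>. The assumption \<open>a < \<Psi> x\<close> supplies the missing point, which
  upgrades the conclusion to \<open>nhds x\<close>.\<close>

lemma lower_semicontinuousD: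
  assumes "lower_semicontinuous \<Psi>" and "a < \<Psi> x"
  shows "eventually (\<lambda>y. a < \<Psi> y) (nhds x)"
proof -
  have "\<Psi> x \<le> Liminf (at x) \<Psi>"
    using assms(1) by (auto simp: lower_semicontinuous_def)
  then have "eventually (\<lambda>y. a < \<Psi> y) (at x)"
    using assms(2) by (auto simp: le_Liminf_iff)
  then have "eventually (\<lambda>y. y \<noteq> x \<longrightarrow> a < \<Psi> y) (nhds x)"
    by (simp add: eventually_at_filter)
  then show ?thesis
    by eventually_elim (use assms(2) in auto)
qed

lemma clarke_deriv_zero_le: "clarke_deriv \<Phi> u 0 \<le> 0"
  unfolding clarke_deriv_def
  by (rule Limsup_bounded) (auto simp: zero_ereal_def)

text \<open>A bound on the difference quotients in direction \<open>z\<close> holds for all base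
  points in a neighbourhood of \<open>u\<close>, hence near every base point close to
  \<open>u\<close>. Replacing \<open>z\<close> by \<open>y\<close> changes a quotient by at most
  \<open>L * dist y z\<close>, by the local Lipschitz condition.\<close>

lemma clarke_deriv_usc:
  fixes \<Phi> :: "'a::real_normed_vector \<Rightarrow> real"
  assumes lip: "locally_lipschitz \<Phi>" and less: "clarke_deriv \<Phi> u z < ereal a"
  shows "eventually (\<lambda>(w, y). clarke_deriv \<Phi> w y \<le> ereal a) (nhds u \<times>\<^sub>F nhds z)"
proof -
  obtain r L where r: "r > 0" and L: "L-lipschitz_on (ball u r) \<Phi>"
    using lip unfolding locally_lipschitz_def by blast
  have L0: "L \<ge> 0"
    using L by (rule lipschitz_on_nonneg)
  \<comment> \<open>The gap \<open>a - b\<close> absorbs the change of direction from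
    \<open>z\<close> to \<open>y\<close>.\<close>
  obtain b where b: "clarke_deriv \<Phi> u z < ereal b" "b < a"
    using ereal_dense2[OF less] by auto
  have "eventually (\<lambda>(w, t). ereal ((\<Phi> (w + t *\<^sub>R z) - \<Phi> w) / t) < ereal b)
          (nhds u \<times>\<^sub>F at_right 0)"
    using Limsup_lessD[OF b(1)[unfolded clarke_deriv_def]] by (simp add: case_prod_unfold)
  then obtain P Q where P: "eventually P (nhds u)" and Q: "eventually Q (at_right (0::real))"
    and PQ: "\<And>w t. P w \<Longrightarrow> Q t \<Longrightarrow> (\<Phi> (w + t *\<^sub>R z) - \<Phi> w) / t < b"
    unfolding eventually_prod_filter by fastforce
  \<comment> \<open>\<open>P'\<close> and \<open>Q'\<close> share the radius: the base point uses at
    most \<open>r / 2\<close> and the increment \<open>t *\<^sub>R x\<close> the other half, for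
    every \<open>x\<close> with \<open>norm x \<le> norm z + 1\<close>.\<close>
  define P' where "P' w \<longleftrightarrow> P w \<and> dist w u < r / 2" for w
  have P': "eventually P' (nhds u)"
  proof -
    have "eventually (\<lambda>w. dist w u < r / 2) (nhds u)"
      unfolding eventually_nhds_metric using r by (intro exI[of _ "r / 2"]) auto
    with P show ?thesis
      by eventually_elim (simp add: P'_def)
  qed
  \<comment> \<open>The 1 keeps \<open>norm y \<le> norm z + 1\<close>; the quotient gives
    \<open>L * dist y z \<le> a - b\<close>, with \<open>L + 1\<close> in place of \<open>L\<close>
    to allow \<open>L = 0\<close>.\<close>
  define e where "e = min 1 ((a - b) / (L + 1))"
  have e: "e > 0"
    using b L0 by (simp add: e_def)
  define Q' where "Q' t \<longleftrightarrow> Q t \<and> 0 < t \<and> t < r / (2 * (norm z + 1))" for t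
  have Q': "eventually Q' (at_right 0)"
  proof -
    have "0 < r / (2 * (norm z + 1))"
      using r by (intro divide_pos_pos) (auto intro: add_nonneg_pos)
    then have "eventually (\<lambda>t. t \<in> {0<..<r / (2 * (norm z + 1))}) (at_right 0)"
      by (rule eventually_at_right_real)
    with Q show ?thesis
      by eventually_elim (auto simp: Q'_def)
  qed
  have quotient: "(\<Phi> (w + t *\<^sub>R y) - \<Phi> w) / t \<le> a"
    if "P' w" "Q' t" "dist y z < e" for w t y
  proof -
    have t: "t > 0" and w: "dist w u < r / 2"
      using that by (auto simp: P'_def Q'_def)
    have in_ball: "w + t *\<^sub>R x \<in> ball u r" if "norm x \<le> norm z + 1" for x
    proof -
      have "t * norm x \<le> t * (norm z + 1)"
        using t that by simp
      also have "\<dots> < r / 2"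
        using \<open>Q' t\<close> by (simp add: Q'_def field_simps add_pos_nonneg)
      finally have "norm (t *\<^sub>R x) < r / 2"
        using t by simp
      moreover have "norm ((w - u) + t *\<^sub>R x) \<le> norm (w - u) + norm (t *\<^sub>R x)"
        by (rule norm_triangle_ineq)
      ultimately have "norm ((w - u) + t *\<^sub>R x) < r"
        using w by (simp add: dist_norm)
      then show ?thesis
        by (simp add: dist_norm norm_minus_commute[of u] algebra_simps)
    qed
    have "norm y \<le> norm z + norm (y - z)"
      by (metis add.commute diff_add_cancel norm_triangle_ineq)
    then have "norm y \<le> norm z + 1"
      using \<open>dist y z < e\<close> by (simp add: e_def dist_norm)
    then have "dist (\<Phi> (w + t *\<^sub>R y)) (\<Phi> (w + t *\<^sub>R z))
        \<le> L * dist (w + t *\<^sub>R y) (w + t *\<^sub>R z)"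
      by (intro lipschitz_onD[OF L] in_ball) auto
    also have "\<dots> = t * (L * dist y z)"
      using t by (simp add: dist_norm flip: scaleR_diff_right)
    finally have "\<Phi> (w + t *\<^sub>R y) - \<Phi> (w + t *\<^sub>R z) \<le> t * (L * dist y z)"
      by (simp add: dist_real_def)
    moreover have "L * dist y z \<le> a - b"
    proof -
      have "L * dist y z \<le> (L + 1) * ((a - b) / (L + 1))"
        using \<open>dist y z < e\<close> L0 b by (intro mult_mono) (auto simp: e_def)
      then show ?thesis
        using L0 by simp
    qed
    then have "t * (L * dist y z) \<le> t * (a - b)"
      using t by simp
    moreover have "\<Phi> (w + t *\<^sub>R z) - \<Phi> w < t * b"
      using PQ[of w t] that t by (simp add: P'_def Q'_def field_simps)
    ultimately have "\<Phi> (w + t *\<^sub>R y) - \<Phi> w \<le> t * a"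
      by (simp add: algebra_simps)
    then show ?thesis
      using t by (simp add: field_simps)
  qed
  \<comment> \<open>The upper limit at \<open>w\<close> sees all base points near \<open>w\<close>,
    so \<open>P'\<close> must hold around \<open>w\<close> and not only at \<open>w\<close>.\<close>
  have "clarke_deriv \<Phi> w y \<le> ereal a" if "eventually P' (nhds w)" "dist y z < e" for w y
    unfolding clarke_deriv_def
  proof (rule Limsup_bounded)
    show "eventually (\<lambda>x. (case x of (w', t) \<Rightarrow> ereal ((\<Phi> (w' + t *\<^sub>R y) - \<Phi> w') / t)) \<le> ereal a)
            (nhds w \<times>\<^sub>F at_right 0)"
      unfolding eventually_prod_filter
      using that Q' quotient by (intro exI[of _ P'] exI[of _ Q']) auto
  qed
  moreover have "eventually (\<lambda>w. eventually P' (nhds w)) (nhds u)"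
    using P' by (simp add: eventually_eventually)
  moreover have "eventually (\<lambda>y. dist y z < e) (nhds z)"
    using e by (auto simp: eventually_nhds_metric)
  ultimately show ?thesis
    unfolding eventually_prod_filter by (intro exI conjI) auto
qed

text \<open>Since \<Phi> is continuous at \<open>l\<close>, the values
  \<open>\<Psi> (u n) = k n - \<Phi> (u n)\<close> tend to \<open>c - \<Phi> l\<close>. The level
  condition for \<open>l\<close> thus amounts to \<open>\<Psi> l = c - \<Phi> l\<close>.\<close>

lemma critical_point_limit_in_critical_set:
  fixes \<Phi> :: "'a::real_normed_vector \<Rightarrow> real"
  assumes lip: "locally_lipschitz \<Phi>" and lsc: "lower_semicontinuous \<Psi>"
    and proper: "proper \<Psi>"
    and crit: "\<And>n. u n \<in> critical_set \<Phi> \<Psi> (k n)"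
    and k: "k \<longlonglongrightarrow> c" and u: "u \<longlonglongrightarrow> l"
  shows "l \<in> critical_set \<Phi> \<Psi> c"
proof -
  obtain r L where r: "r > 0" and L: "L-lipschitz_on (ball l r) \<Phi>"
    using lip unfolding locally_lipschitz_def by blast
  have "continuous_on (ball l r) \<Phi>"
    using L by (rule lipschitz_on_continuous_on)
  then have "isCont \<Phi> l"
    using r by (simp add: continuous_on_eq_continuous_at)
  then have "(\<lambda>n. \<Phi> (u n)) \<longlonglongrightarrow> \<Phi> l"
    using u by (rule isCont_tendsto_compose)
  then have lim: "(\<lambda>n. k n - \<Phi> (u n)) \<longlonglongrightarrow> c - \<Phi> l"
    by (intro tendsto_diff k)
  have \<Psi>u: "\<Psi> (u n) = ereal (k n - \<Phi> (u n))" for n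
    using crit[of n] by (cases "\<Psi> (u n)") (auto simp: critical_set_def energy_def)
  have \<Psi>l_le: "\<Psi> l \<le> ereal (c - \<Phi> l)"
  proof (rule ccontr)
    assume "\<not> ?thesis"
    then obtain b where b: "c - \<Phi> l < b" "ereal b < \<Psi> l"
      using ereal_dense2[of "ereal (c - \<Phi> l)" "\<Psi> l"] by (auto simp: not_le)
    have "eventually (\<lambda>n. ereal b < \<Psi> (u n)) sequentially"
      using lower_semicontinuousD[OF lsc b(2)] u by (rule eventually_compose_filterlim)
    then have "eventually (\<lambda>n. b \<le> k n - \<Phi> (u n)) sequentially"
      by eventually_elim (simp add: \<Psi>u)
    then have "b \<le> c - \<Phi> l"
      using lim by (intro tendsto_lowerbound[OF lim]) auto
    with b show False by simp
  qed
  \<comment> \<open>Criticality of \<open>u n\<close> tested at \<open>v\<close>, passed to the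
    limit. Real upper bounds \<open>a\<close> and \<open>p\<close> keep infinite values out of the
    limit. It serves twice: with \<open>v = l\<close> for the value of \<open>\<Psi> l\<close>, then
    with arbitrary \<open>v\<close> for criticality.\<close>
  have test: "ereal (c - \<Phi> l) \<le> ereal (a + p)"
    if "clarke_deriv \<Phi> l (v - l) < ereal a" and p: "\<Psi> v \<le> ereal p" for v a p
  proof -
    have "filterlim (\<lambda>n. (u n, v - u n)) (nhds l \<times>\<^sub>F nhds (v - l)) sequentially"
      by (intro filterlim_Pair u tendsto_intros)
    with clarke_deriv_usc[OF lip that(1)]
    have "eventually (\<lambda>n. clarke_deriv \<Phi> (u n) (v - u n) \<le> ereal a) sequentially"
      by (drule_tac eventually_compose_filterlim) auto
    then have "eventually (\<lambda>n. k n - \<Phi> (u n) \<le> a + p) sequentially"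
    proof eventually_elim
      case (elim n)
      have "0 \<le> clarke_deriv \<Phi> (u n) (v - u n) + \<Psi> v - \<Psi> (u n)"
        using crit[of n] by (auto simp: critical_set_def critical_point_def)
      also have "\<dots> \<le> ereal a + ereal p - \<Psi> (u n)"
        by (intro ereal_minus_mono add_mono elim p order_refl)
      finally show ?case
        by (simp add: \<Psi>u)
    qed
    then show ?thesis
      using tendsto_upperbound[OF lim] by auto
  qed
  have \<Psi>l_ge: "ereal (c - \<Phi> l) \<le> \<Psi> l"
  proof (rule ccontr)
    assume "\<not> ?thesis"
    then obtain p where p: "\<Psi> l < ereal p" "p < c - \<Phi> l"
      using ereal_dense2[of "\<Psi> l" "ereal (c - \<Phi> l)"] by (auto simp: not_le)
    \<comment> \<open>Half the gap is positive, so it exceeds the derivative in direction 0, yet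
      adding it to \<open>p\<close> stays below \<open>c - \<Phi> l\<close>.\<close>
    have "clarke_deriv \<Phi> l (l - l) < ereal ((c - \<Phi> l - p) / 2)"
      using clarke_deriv_zero_le[of \<Phi> l] p(2) by (auto intro: le_less_trans)
    then have "c - \<Phi> l \<le> (c - \<Phi> l - p) / 2 + p"
      using test[of l "(c - \<Phi> l - p) / 2" p] p by auto
    with p(2) show False by (simp add: field_simps)
  qed
  with \<Psi>l_le have \<Psi>l: "\<Psi> l = ereal (c - \<Phi> l)"
    by (rule order_antisym)
  have "0 \<le> clarke_deriv \<Phi> l (v - l) + \<Psi> v - \<Psi> l" for v
  proof (rule ccontr)
    assume neg: "\<not> ?thesis"
    \<comment> \<open>As \<open>\<Psi> l\<close> is finite, \<open>\<Psi> v = \<infinity>\<close>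
      would make the whole expression infinite, whatever the derivative is.\<close>
    then have "\<Psi> v \<noteq> \<infinity>"
      by (auto simp: \<Psi>l)
    moreover have "\<Psi> v \<noteq> -\<infinity>"
      using proper by (simp add: proper_def)
    ultimately obtain p where p: "\<Psi> v = ereal p"
      by (cases "\<Psi> v") auto
    then have less: "clarke_deriv \<Phi> l (v - l) < ereal (c - \<Phi> l - p)"
      using neg by (cases "clarke_deriv \<Phi> l (v - l)") (auto simp: \<Psi>l)
    obtain a where a: "clarke_deriv \<Phi> l (v - l) < ereal a" "a < c - \<Phi> l - p"
      using ereal_dense2[OF less] by auto
    from test[OF a(1), of p] p a(2) show False by simp
  qed
  then show ?thesis
    by (auto simp: critical_set_def critical_point_def energy_def \<Psi>l)
qed

text \<open>Exact critical points satisfy the inequality with right-hand side 0, so any positive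
  null sequence can serve as the error.\<close>

lemma PS_sequence_critical:
  assumes crit: "\<And>n. u n \<in> critical_set \<Phi> \<Psi> (k n)" and k: "k \<longlonglongrightarrow> c"
  shows "PS_sequence \<Phi> \<Psi> c u"
  unfolding PS_sequence_def
proof (intro conjI exI[of _ "\<lambda>n. inverse (real (Suc n))"] allI)
  show "(\<lambda>n. energy \<Phi> \<Psi> (u n)) \<longlonglongrightarrow> ereal c"
    using crit k by (simp add: critical_set_def)
  show "(\<lambda>n. inverse (real (Suc n))) \<longlonglongrightarrow> 0"
    by (rule LIMSEQ_inverse_real_of_nat)
  show "ereal (- inverse (real (Suc n)) * norm (v - u n))
      \<le> clarke_deriv \<Phi> (u n) (v - u n) + \<Psi> v - \<Psi> (u n)" for n v
  proof -
    have "ereal (- inverse (real (Suc n)) * norm (v - u n)) \<le> 0"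
      by (simp add: zero_ereal_def)
    also have "0 \<le> clarke_deriv \<Phi> (u n) (v - u n) + \<Psi> v - \<Psi> (u n)"
      using crit[of n] by (auto simp: critical_set_def critical_point_def)
    finally show ?thesis .
  qed
qed simp

theorem lemma3p10:
  fixes \<Phi> :: "'a::banach \<Rightarrow> real"
    and \<Psi> :: "'a \<Rightarrow> ereal"
    and cs :: "nat \<Rightarrow> real"
    and c \<delta> :: real
  assumes "locally_lipschitz \<Phi>"
    and "convex_ereal \<Psi>"
    and "lower_semicontinuous \<Psi>"
    and "proper \<Psi>"
    and "PS_condition \<Phi> \<Psi>"
    and "cs \<longlonglongrightarrow> c"
    and "\<delta> > 0"
  shows "\<exists>j\<^sub>0. \<forall>j\<ge>j\<^sub>0. critical_set \<Phi> \<Psi> (cs j) \<subseteq> closed_nbhd \<delta> (critical_set \<Phi> \<Psi> c)"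
proof (rule ccontr)
  let ?N = "closed_nbhd \<delta> (critical_set \<Phi> \<Psi> c)"
  assume "\<not> ?thesis"
  then have "\<forall>n. \<exists>j u. j \<ge> n \<and> u \<in> critical_set \<Phi> \<Psi> (cs j) \<and> u \<notin> ?N"
    by (meson subsetI)
  then obtain s u where s: "\<And>n. s n \<ge> n"
    and u: "\<And>n. u n \<in> critical_set \<Phi> \<Psi> (cs (s n))" "\<And>n. u n \<notin> ?N"
    by metis
  \<comment> \<open>The bound \<open>s n \<ge> n\<close> alone drives the indices to infinity;
    \<open>s\<close> may repeat values or decrease.\<close>
  have "filterlim s at_top sequentially"
    using s by (intro filterlim_at_top_mono[OF filterlim_ident]) auto
  with \<open>cs \<longlonglongrightarrow> c\<close> have cs_s: "(\<lambda>n. cs (s n)) \<longlonglongrightarrow> c"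
    by (rule filterlim_compose)
  have "PS_sequence \<Phi> \<Psi> c u"
    using u(1) cs_s by (rule PS_sequence_critical)
  then obtain r l where r: "strict_mono r" and l: "(u \<circ> r) \<longlonglongrightarrow> l"
    using \<open>PS_condition \<Phi> \<Psi>\<close> unfolding PS_condition_def convergent_def by blast
  have l_crit: "l \<in> critical_set \<Phi> \<Psi> c"
  proof (rule critical_point_limit_in_critical_set)
    show "(u \<circ> r) \<longlonglongrightarrow> l"
      by (rule l)
    show "(u \<circ> r) n \<in> critical_set \<Phi> \<Psi> (((\<lambda>n. cs (s n)) \<circ> r) n)" for n
      using u(1) by simp
    show "((\<lambda>n. cs (s n)) \<circ> r) \<longlonglongrightarrow> c"
      using cs_s r by (rule LIMSEQ_subseq_LIMSEQ)
  qed (use assms in auto)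
  from l \<open>\<delta> > 0\<close> obtain n where "dist (u (r n)) l < \<delta>"
    by (auto simp: lim_sequentially)
  then have "infdist (u (r n)) (critical_set \<Phi> \<Psi> c) \<le> \<delta>"
    using infdist_le[OF l_crit, of "u (r n)"] by simp
  \<comment> \<open>Besides bounding the distance, \<open>l\<close> witnesses that the critical set
    at level \<open>c\<close> is nonempty, as \<open>closed_nbhd\<close> demands.\<close>
  then have "u (r n) \<in> ?N"
    using l_crit by (auto simp: closed_nbhd_def)
  with u(2) show False by blast
qed

end
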